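(* Let $\ell \geq 1$, $s \geq 0$, $M \geq 0$ with $M \geq s$ be integers. Then \[ \sum_{n=s}^{M} (2\ell n +1) \left(2\ell^2n^2 + 2\ell n +1 -\ell^2 s^2 \right) \frac{\left(\frac{1}{\ell}\right)_{n+s} \left(\frac{1}{\ell}\right)_{n-s} \left(\frac{1}{\ell}\right)_{n}^2}{(1)_{n+s} (1)_{n-s} (1)_{n}^2}= \frac{\left(1+\frac{1}{\ell}\right)_{M+s} \left(1+\frac{1}{\ell}\right)_{M-s} \left(1+\frac{1}{\ell}\right)_{M}^2}{(1)_{M+s} (1)_{M-s} (1)_{M}^2}. \]
   Context: For a real number $a$ and integer $n\ge 0$, the rising factorial is $(a)_0=1$ and $(a)_n=a(a+1)\cdots(a+n-1)$ for $n\geq 1$. *)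

theory Defs
  imports Complex_Main
begin

end

theory Submission
  imports Defs
begin

text \<open>
  Write $r_k = (1/c)_k / (1)_k$ and $R_k = (1 + 1/c)_k / (1)_k$. Then $R_k = (1 + c k)\, r_k$ and
  $R_k = c (k+1)\, r_{k+1}$, so the right-hand sides for $M$ and $M-1$ are both multiples of
  $r_{M+s} r_{M-s} r_M^2$. With $x = c M$ and $y = c s$ their difference is governed by
  $((1+x)^2 - y^2)(1+x)^2 - (x^2 - y^2) x^2 = (2x+1)(2x^2 + 2x + 1 - y^2)$, and the sum telescopes.
\<close>

text \<open>Since \<open>pochhammer 1 k\<close> is k!, this is the coefficient of z^k in (1 -
  z)^(-a).\<close>

definition poch_ratio :: "'a \<Rightarrow> nat \<Rightarrow> 'a::field_char_0" where
  "poch_ratio a k = pochhammer a k / pochhammer 1 k"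

lemma poch_ratio_shift:
  assumes "c \<noteq> 0"
  shows "poch_ratio (1 + 1 / c) k = (1 + c * of_nat k) * poch_ratio (1 / c) k"
proof -
  \<comment> \<open>Both sides are \<open>pochhammer (1 / c) (Suc k)\<close>, with its first or its
    last factor split off.\<close>
  have "1 / c * pochhammer (1 / c + 1) k = pochhammer (1 / c) k * (1 / c + of_nat k)"
    by (metis pochhammer_Suc pochhammer_rec)
  then have "pochhammer (1 + 1 / c) k = (1 + c * of_nat k) * pochhammer (1 / c) k"
    using assms by (simp add: field_simps)
  then show ?thesis
    by (simp add: poch_ratio_def)
qed

text \<open>Split the first factor off the numerator (1/c)_(k+1) and the last factor off the
  denominator (k+1)!.\<close>

lemma poch_ratio_shift_Suc:
  assumes "c \<noteq> 0"
  shows "poch_ratio (1 + 1 / c) k = c * of_nat (Suc k) * poch_ratio (1 / c) (Suc k)"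
proof -
  have "pochhammer (1 / c) (Suc k) = 1 / c * pochhammer (1 + 1 / c) k"
    by (simp add: pochhammer_rec add.commute)
  moreover have "pochhammer (1::'a) (Suc k) = of_nat (Suc k) * pochhammer 1 k"
    by (simp add: pochhammer_Suc mult.commute)
  moreover have "of_nat (Suc k) \<noteq> (0::'a)"
    by (rule of_nat_neq_0)
  ultimately show ?thesis
    using assms by (simp add: poch_ratio_def del: of_nat_Suc)
qed

lemma sum_poch_ratio_telescope:
  fixes c :: "'a::field_char_0"
  assumes "c \<noteq> 0" and "s \<le> M"
  shows "(\<Sum>n = s..M.
            (2 * c * of_nat n + 1)
            * (2 * c\<^sup>2 * (of_nat n)\<^sup>2 + 2 * c * of_nat n + 1 - c\<^sup>2 * (of_nat s)\<^sup>2)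
            * (poch_ratio (1 / c) (n + s) * poch_ratio (1 / c) (n - s) * (poch_ratio (1 / c) n)\<^sup>2))
         = poch_ratio (1 + 1 / c) (M + s) * poch_ratio (1 + 1 / c) (M - s)
             * (poch_ratio (1 + 1 / c) M)\<^sup>2"
  using \<open>s \<le> M\<close>
proof (induction M rule: dec_induct)
  case base
  \<comment> \<open>With n = s and y = c s the weight collapses to (1 + 2y)(1 + y)^2, which is what
    the shifts at the indices 2s, 0 and s (squared) produce.\<close>
  show ?case
    by (simp add: poch_ratio_shift[OF \<open>c \<noteq> 0\<close>] power2_eq_square algebra_simps)
next
  case (step m)
  \<comment> \<open>\<open>x\<close> belongs to the index \<open>Suc m\<close> of the newly added
    summand, and \<open>t\<close> is that summand without its polynomial weight.\<close>
  define x y where "x = c * of_nat (Suc m)" and "y = c * of_nat s"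
  define t where
    "t = poch_ratio (1 / c) (Suc m + s) * poch_ratio (1 / c) (Suc m - s)
           * (poch_ratio (1 / c) (Suc m))\<^sup>2"
  \<comment> \<open>Here s \<le> m keeps the truncated subtraction exact.\<close>
  have diff: "Suc m - s = Suc (m - s)"
    using step.hyps by simp
  have x_plus: "c * of_nat (Suc (m + s)) = x + y"
    and x_minus: "c * of_nat (Suc (m - s)) = x - y"
    using step.hyps by (simp_all add: x_def y_def of_nat_diff algebra_simps)
  \<comment> \<open>The old closed form needs the shift that raises each index by one, to reach the
    indices in \<open>t\<close>; the new closed form below already has them and needs the shift that
    keeps the index.\<close>
  have before: "poch_ratio (1 + 1 / c) (m + s) * poch_ratio (1 + 1 / c) (m - s)
                  * (poch_ratio (1 + 1 / c) m)\<^sup>2 = (x + y) * (x - y) * x\<^sup>2 * t"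
    unfolding poch_ratio_shift_Suc[OF \<open>c \<noteq> 0\<close>] x_plus x_minus x_def[symmetric] t_def diff add_Suc
    by (simp only: power_mult_distrib mult_ac)
  have after: "poch_ratio (1 + 1 / c) (Suc m + s) * poch_ratio (1 + 1 / c) (Suc m - s)
                 * (poch_ratio (1 + 1 / c) (Suc m))\<^sup>2
               = (1 + (x + y)) * (1 + (x - y)) * (1 + x)\<^sup>2 * t"
    unfolding poch_ratio_shift[OF \<open>c \<noteq> 0\<close>] t_def diff add_Suc x_plus x_minus x_def[symmetric]
    by (simp only: power_mult_distrib mult_ac)
  have weight: "(2 * c * of_nat (Suc m) + 1)
      * (2 * c\<^sup>2 * (of_nat (Suc m))\<^sup>2 + 2 * c * of_nat (Suc m) + 1 - c\<^sup>2 * (of_nat s)\<^sup>2)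
      = (2 * x + 1) * (2 * x\<^sup>2 + 2 * x + 1 - y\<^sup>2)"
    by (simp only: x_def y_def power_mult_distrib mult.assoc)
  have "(2 * x + 1) * (2 * x\<^sup>2 + 2 * x + 1 - y\<^sup>2) * t + (x + y) * (x - y) * x\<^sup>2 * t
        = (1 + (x + y)) * (1 + (x - y)) * (1 + x)\<^sup>2 * t"
    by algebra
  moreover have "s \<le> Suc m"
    using step.hyps by simp
  ultimately show ?case
    by (simp only: sum.nat_ivl_Suc' step.IH before after weight t_def[symmetric])
qed

theorem theorem1p2:
  fixes l s M :: nat
  assumes "l \<ge> 1" and "M \<ge> s"
  shows "(\<Sum>n = s..M.
            (2 * real l * real n + 1)
            * (2 * (real l)\<^sup>2 * (real n)\<^sup>2 + 2 * real l * real n + 1 - (real l)\<^sup>2 * (real s)\<^sup>2)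
            * ((pochhammer (1 / real l) (n + s) * pochhammer (1 / real l) (n - s)
                * (pochhammer (1 / real l) n)\<^sup>2)
               / (pochhammer 1 (n + s) * pochhammer 1 (n - s) * (pochhammer 1 n)\<^sup>2)))
         = (pochhammer (1 + 1 / real l) (M + s) * pochhammer (1 + 1 / real l) (M - s)
              * (pochhammer (1 + 1 / real l) M)\<^sup>2)
           / (pochhammer 1 (M + s) * pochhammer 1 (M - s) * (pochhammer 1 M)\<^sup>2)"
proof -
  have "real l \<noteq> 0"
    using assms(1) by simp
  from sum_poch_ratio_telescope[OF this assms(2)] show ?thesis
    by (simp only: poch_ratio_def times_divide_times_eq power_divide)
qed

end
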